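(* For every $n\ge 1$, the pairs of statistics $(\mathrm{das},\mathrm{mix})$ and $(\mathrm{des},\mathrm{inv})$ are equidistributed on $\mathfrak{S}_n$: for all $a,b\in\mathbb{N}=\{0,1,2,\dots\}$, $$|\{\pi\in\mathfrak{S}_n:(\mathrm{das},\mathrm{mix})\,\pi=(a,b)\}|=|\{\pi\in\mathfrak{S}_n:(\mathrm{des},\mathrm{inv})\,\pi=(a,b)\}|.$$
   Context: $\mathfrak{S}_n$ is the set of permutations of $[n]=\{1,\dots,n\}$, written as words $\pi(1)\cdots\pi(n)$. $\mathrm{des}\,\pi=|\{i\in[n-1]:\pi(i)>\pi(i+1)\}|$ and $\mathrm{inv}\,\pi=|\{(i,j): i<j,\ \pi(i)>\pi(j)\}|$. The entry $\pi(i)$ is a left-to-right maximum of $\pi$ if $\pi(i)>\pi(h)$ for all $h<i$. $\mathrm{mix}\,\pi$ is the number of pairs of positions $i<j$ such that either (1) $\pi(i)>\pi(j)$ and $\pi(i)$ is a left-to-right maximum of $\pi$, or (2) $\pi(i)<\pi(j)$ and there is $k<i$ with $\pi(k)>\pi(j)$. $\mathrm{das}\,\pi$ is the number of positions $i\in[n-1]$ such that either (1) $\pi(i)>\pi(i+1)$ and $\pi(i)$ is a left-to-right maximum of $\pi$, or (2) $\pi(i)<\pi(i+1)$ and there is $k<i$ with $\pi(k)>\pi(i+1)$. *)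

theory Defs
  imports "HOL-Combinatorics.Permutations"
begin

(* A permutation of [n] is a function p with "p permutes {1..n}"; as p does not determine n,
   each statistic takes n as a parameter.  Positions are 1-based. *)

definition des :: "nat \<Rightarrow> (nat \<Rightarrow> nat) \<Rightarrow> nat" where
  "des n p = card {i \<in> {1..n-1}. p i > p (i + 1)}"

definition inv_stat :: "nat \<Rightarrow> (nat \<Rightarrow> nat) \<Rightarrow> nat" where
  "inv_stat n p = card {(i, j). i \<in> {1..n} \<and> j \<in> {1..n} \<and> i < j \<and> p i > p j}"

(* p i is a left-to-right maximum, for a position i \<ge> 1 *)
definition lr_max :: "(nat \<Rightarrow> nat) \<Rightarrow> nat \<Rightarrow> bool" where
  "lr_max p i \<longleftrightarrow> (\<forall>h\<in>{1..<i}. p i > p h)"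

definition mix :: "nat \<Rightarrow> (nat \<Rightarrow> nat) \<Rightarrow> nat" where
  "mix n p = card {(i, j). i \<in> {1..n} \<and> j \<in> {1..n} \<and> i < j \<and>
     (p i > p j \<and> lr_max p i \<or> p i < p j \<and> (\<exists>k\<in>{1..<i}. p k > p j))}"

definition das :: "nat \<Rightarrow> (nat \<Rightarrow> nat) \<Rightarrow> nat" where
  "das n p = card {i \<in> {1..n-1}.
     p i > p (i + 1) \<and> lr_max p i \<or> p i < p (i + 1) \<and> (\<exists>k\<in>{1..<i}. p k > p (i + 1))}"

end

(* Summing mix over the first index i of its pairs gives m(1) + ... + m(n), just as inv is the sum
   of the Lehmer code c(1), ..., c(n).  Both p |-> c and p |-> m are bijections onto the words with
   i-th letter in {0..n-i}: a letter determines p(i) once p(1), ..., p(i-1) are known, and there are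
   n! such words.  A descent of p is a descent of the word c, and a position counted by das is a
   descent of the word m, so both pairs of statistics become (descents, sum) on the same words. *)

theory Submission
  imports Defs
begin

section \<open>Codes of permutations and the words they range over\<close>

text \<open>In \<open>r K x v\<close>, \<open>K\<close> is the set of entries to the left of the entry \<open>x\<close>, and \<open>v\<close> is an entry
  to its right.\<close>

definition code :: "(nat set \<Rightarrow> nat \<Rightarrow> nat \<Rightarrow> bool) \<Rightarrow> nat \<Rightarrow> (nat \<Rightarrow> nat) \<Rightarrow> nat \<Rightarrow> nat" where
  "code r n p = (\<lambda>i\<in>{1..n}. card {j \<in> {i<..n}. r (p ` {1..<i}) (p i) (p j)})"

definition inv_rel :: "nat set \<Rightarrow> nat \<Rightarrow> nat \<Rightarrow> bool" where
  "inv_rel K x v \<longleftrightarrow> v < x"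

definition mix_rel :: "nat set \<Rightarrow> nat \<Rightarrow> nat \<Rightarrow> bool" where
  "mix_rel K x v \<longleftrightarrow> v < x \<and> (\<forall>k\<in>K. k < x) \<or> x < v \<and> (\<exists>k\<in>K. v < k)"

text \<open>The extensional product fixes the values outside {1..n}, as the restriction in
  \<open>code\<close> does, so words can be compared as functions and counted.\<close>

definition codewords :: "nat \<Rightarrow> (nat \<Rightarrow> nat) set" where
  "codewords n = (\<Pi>\<^sub>E i\<in>{1..n}. {0..n - i})"

lemma code_in_codewords: "code r n p \<in> codewords n"
proof -
  have "card {j \<in> {i<..n}. r (p ` {1..<i}) (p i) (p j)} \<le> n - i" for i
    by (rule order.trans[OF card_mono[of "{i<..n}"]]) auto
  then show ?thesis by (auto simp: code_def codewords_def)
qed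

lemma card_codewords: "card (codewords n) = fact n"
proof -
  have "card (codewords n) = (\<Prod>i = 1..n. Suc (n - i))"
    by (simp add: codewords_def card_PiE)
  also have "\<dots> = (\<Prod>i = 1..n. i)"
    by (rule prod.reindex_bij_witness[of _ "\<lambda>i. Suc n - i" "\<lambda>i. Suc n - i"]) auto
  also have "\<dots> = fact n"
    by (simp add: fact_prod)
  finally show ?thesis .
qed

lemma finite_codewords: "finite (codewords n)"
  by (simp add: codewords_def finite_PiE)

text \<open>Counting values instead of positions shows that the letter depends only on
  \<open>p i\<close> and the set of earlier entries, which permits decoding from left to
  right.\<close>

lemma code_eq_card_values:
  assumes p: "p permutes {1..n}" and i: "i \<in> {1..n}" and irrefl: "\<And>K x. \<not> r K x x"
  shows "code r n p i = card {v \<in> {1..n} - p ` {1..<i}. r (p ` {1..<i}) (p i) v}"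
proof -
  have inj: "inj p" using p by (rule permutes_inj)
  have "{1..n} - p ` {1..<i} = p ` {1..n} - p ` {1..<i}"
    using permutes_image[OF p] by simp
  also have "\<dots> = p ` {i..n}"
    using i by (subst image_set_diff[OF inj, symmetric]) (rule arg_cong[of _ _ "image p"], auto)
  finally have "{v \<in> {1..n} - p ` {1..<i}. r (p ` {1..<i}) (p i) v}
      = p ` {j \<in> {i..n}. r (p ` {1..<i}) (p i) (p j)}"
    by auto
  also have "{j \<in> {i..n}. r (p ` {1..<i}) (p i) (p j)} = {j \<in> {i<..n}. r (p ` {1..<i}) (p i) (p j)}"
    using irrefl by (auto simp: order.order_iff_strict)
  finally show ?thesis
    using i inj by (simp add: code_def card_image inj_on_subset)
qed

lemma bij_betw_code:
  assumes irrefl: "\<And>K x. \<not> r K x x"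
    and inj: "\<And>K U. finite U \<Longrightarrow> K \<inter> U = {} \<Longrightarrow> inj_on (\<lambda>x. card {v \<in> U. r K x v}) U"
  shows "bij_betw (code r n) {p. p permutes {1..n}} (codewords n)"
proof -
  have "inj_on (code r n) {p. p permutes {1..n}}"
  proof (rule inj_onI, clarify)
    fix p q assume p: "p permutes {1..n}" and q: "q permutes {1..n}"
      and eq: "code r n p = code r n q"
    have agree: "i \<in> {1..n} \<Longrightarrow> p i = q i" for i
    proof (induction i rule: less_induct)
      case (less i)
      have K: "p ` {1..<i} = q ` {1..<i}"
        using less by (intro image_cong) auto
      have new: "f i \<in> {1..n} - f ` {1..<i}" if "f permutes {1..n}" for f
        using that less.prems permutes_in_image[OF that, of i] permutes_inj[OF that]
        by (auto simp: inj_image_mem_iff)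
      show ?case
      proof (rule inj_onD[OF inj[of "{1..n} - p ` {1..<i}" "p ` {1..<i}"]])
        show "card {v \<in> {1..n} - p ` {1..<i}. r (p ` {1..<i}) (p i) v}
            = card {v \<in> {1..n} - p ` {1..<i}. r (p ` {1..<i}) (q i) v}"
          using code_eq_card_values[of p n i r, OF p less.prems irrefl]
            code_eq_card_values[of q n i r, OF q less.prems irrefl] eq K by simp
      qed (use new[OF p] new[OF q] K in auto)
    qed
    show "p = q"
    proof
      fix i show "p i = q i"
        using agree[of i] permutes_not_in[OF p, of i] permutes_not_in[OF q, of i] by metis
    qed
  qed
  moreover have "card {p. p permutes {1..n}} = card (codewords n)"
    by (simp add: card_permutations[OF refl] card_codewords)
  ultimately have "code r n ` {p. p permutes {1..n}} = codewords n"
    using code_in_codewords finite_codewords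
    by (intro card_subset_eq) (auto simp: card_image)
  with \<open>inj_on _ _\<close> show ?thesis by (simp add: bij_betw_def)
qed

lemma bij_betw_code_inv: "bij_betw (code inv_rel n) {p. p permutes {1..n}} (codewords n)"
proof (rule bij_betw_code)
  fix K U :: "nat set" assume "finite U"
  then have "card {v \<in> U. inv_rel K x v} < card {v \<in> U. inv_rel K y v}"
    if "x \<in> U" "y \<in> U" "x < y" for x y
    using that by (intro psubset_card_mono) (auto simp: inv_rel_def)
  then show "inj_on (\<lambda>x. card {v \<in> U. inv_rel K x v}) U"
    by (intro linorder_inj_onI') fastforce+
qed (simp add: inv_rel_def)

text \<open>List first, in decreasing order, the elements of U exceeded by some element of K, then
  the others in increasing order. On U, \<open>mix_rel K x v\<close> says that v precedes x in this
  list, so the count is the rank of x.\<close>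

lemma bij_betw_code_mix: "bij_betw (code mix_rel n) {p. p permutes {1..n}} (codewords n)"
proof (rule bij_betw_code)
  fix K U :: "nat set" assume U: "finite U" and disj: "K \<inter> U = {}"
  have "card {v \<in> U. mix_rel K x v} \<noteq> card {v \<in> U. mix_rel K y v}"
    if xy: "x \<in> U" "y \<in> U" "x < y" for x y
  proof (cases "\<forall>k\<in>K. k < y")
    case True
    \<comment> \<open>Here y is in the increasing part, so x precedes it whichever part contains
      x.\<close>
    have "mix_rel K y v" if "mix_rel K x v" for v
      using that True xy unfolding mix_rel_def by (metis less_trans)
    moreover have "mix_rel K y x" "\<not> mix_rel K x x"
      using xy True by (simp_all add: mix_rel_def)
    ultimately have "{v \<in> U. mix_rel K x v} \<subset> {v \<in> U. mix_rel K y v}"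
      using xy by blast
    then have "card {v \<in> U. mix_rel K x v} < card {v \<in> U. mix_rel K y v}"
      using U by (intro psubset_card_mono) auto
    then show ?thesis by simp
  next
    case False
    \<comment> \<open>Now x and y are both in the decreasing part, so y precedes x. Disjointness of
      K and U makes the bound on y strict.\<close>
    then obtain k where "k \<in> K" "y \<le> k" by auto
    moreover have "k \<noteq> y" using \<open>k \<in> K\<close> disj xy by blast
    ultimately have k: "k \<in> K" "y < k" by simp_all
    have "mix_rel K x v" if "mix_rel K y v" for v
      using that False xy by (auto simp: mix_rel_def)
    moreover have "mix_rel K x y" "\<not> mix_rel K y y"
      using xy k by (auto simp: mix_rel_def)
    ultimately have "{v \<in> U. mix_rel K y v} \<subset> {v \<in> U. mix_rel K x v}"
      using xy by blast
    then have "card {v \<in> U. mix_rel K y v} < card {v \<in> U. mix_rel K x v}"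
      using U by (intro psubset_card_mono) auto
    then show ?thesis by simp
  qed
  then show "inj_on (\<lambda>x. card {v \<in> U. mix_rel K x v}) U"
    by (intro linorder_inj_onI') auto
qed (simp add: mix_rel_def)

section \<open>Sums of codes\<close>

lemma sum_code:
  "sum (code r n p) {1..n} =
    card {(i, j). i \<in> {1..n} \<and> j \<in> {1..n} \<and> i < j \<and> r (p ` {1..<i}) (p i) (p j)}"
proof -
  have "sum (code r n p) {1..n} = card (SIGMA i:{1..n}. {j \<in> {i<..n}. r (p ` {1..<i}) (p i) (p j)})"
    by (simp add: code_def)
  also have "(SIGMA i:{1..n}. {j \<in> {i<..n}. r (p ` {1..<i}) (p i) (p j)})
      = {(i, j). i \<in> {1..n} \<and> j \<in> {1..n} \<and> i < j \<and> r (p ` {1..<i}) (p i) (p j)}"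
    by auto
  finally show ?thesis .
qed

lemma inv_stat_eq_sum_code: "inv_stat n p = sum (code inv_rel n p) {1..n}"
  unfolding sum_code inv_stat_def inv_rel_def by (rule refl)

lemma mix_eq_sum_code: "mix n p = sum (code mix_rel n p) {1..n}"
  unfolding sum_code mix_def mix_rel_def lr_max_def by simp

section \<open>Descents of codes\<close>

definition word_des :: "nat \<Rightarrow> (nat \<Rightarrow> nat) \<Rightarrow> nat" where
  "word_des n c = card {i \<in> {1..n-1}. c i > c (i + 1)}"

text \<open>Every position counted at i + 1 is counted at i, where i + 1 itself is counted
  too.\<close>

lemma code_descentI:
  assumes "i \<in> {1..n-1}" "r (p ` {1..<i}) (p i) (p (i + 1))"
    and "\<And>j. i + 1 < j \<Longrightarrow> j \<le> n \<Longrightarrow> r (p ` {1..<i+1}) (p (i + 1)) (p j) \<Longrightarrow> r (p ` {1..<i}) (p i) (p j)"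
  shows "code r n p i > code r n p (i + 1)"
proof -
  have "{j \<in> {i+1<..n}. r (p ` {1..<i+1}) (p (i + 1)) (p j)} \<subseteq>
      {j \<in> {i<..n}. r (p ` {1..<i}) (p i) (p j)}"
    using assms(3) by auto
  moreover have "i + 1 \<in> {j \<in> {i<..n}. r (p ` {1..<i}) (p i) (p j)}"
    "i + 1 \<notin> {j \<in> {i+1<..n}. r (p ` {1..<i+1}) (p (i + 1)) (p j)}"
    using assms(1,2) by auto
  ultimately have "{j \<in> {i+1<..n}. r (p ` {1..<i+1}) (p (i + 1)) (p j)} \<subset>
      {j \<in> {i<..n}. r (p ` {1..<i}) (p i) (p j)}"
    by blast
  then have "card {j \<in> {i+1<..n}. r (p ` {1..<i+1}) (p (i + 1)) (p j)} <
      card {j \<in> {i<..n}. r (p ` {1..<i}) (p i) (p j)}"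
    by (intro psubset_card_mono) auto
  then show ?thesis using assms(1) by (auto simp: code_def)
qed

text \<open>Position i + 1 is not counted at i, so everything counted there lies to the right of i +
  1 and is counted again.\<close>

lemma code_ascentI:
  assumes "i \<in> {1..n-1}" "\<not> r (p ` {1..<i}) (p i) (p (i + 1))"
    and "\<And>j. i + 1 < j \<Longrightarrow> j \<le> n \<Longrightarrow> r (p ` {1..<i}) (p i) (p j) \<Longrightarrow> r (p ` {1..<i+1}) (p (i + 1)) (p j)"
  shows "code r n p i \<le> code r n p (i + 1)"
proof -
  have "j \<noteq> i + 1" if "r (p ` {1..<i}) (p i) (p j)" for j
    using that assms(2) by auto
  then have "{j \<in> {i<..n}. r (p ` {1..<i}) (p i) (p j)} \<subseteq>
      {j \<in> {i+1<..n}. r (p ` {1..<i+1}) (p (i + 1)) (p j)}"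
    using assms(3) by force
  then have "card {j \<in> {i<..n}. r (p ` {1..<i}) (p i) (p j)} \<le>
      card {j \<in> {i+1<..n}. r (p ` {1..<i+1}) (p (i + 1)) (p j)}"
    by (intro card_mono) auto
  then show ?thesis using assms(1) by (auto simp: code_def)
qed

lemma des_eq_word_des_code: "des n p = word_des n (code inv_rel n p)"
proof -
  have "p i > p (i + 1) \<longleftrightarrow> code inv_rel n p i > code inv_rel n p (i + 1)"
    if "i \<in> {1..n-1}" for i
    using that code_descentI[of i n inv_rel p] code_ascentI[of i n inv_rel p]
    by (cases "p i > p (i + 1)") (force simp: inv_rel_def)+
  then show ?thesis
    unfolding des_def word_des_def by (intro arg_cong[of _ _ card]) auto
qed

text \<open>If x < y < k with k in K, then v lies above y and below an element of K, hence above x.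
  Otherwise x exceeds y and all of K, so y is no left-to-right maximum after x, and v is below
  x.\<close>

lemma mix_rel_insertD:
  assumes "mix_rel K x y" "mix_rel (insert x K) y v"
  shows "mix_rel K x v"
proof (cases "x < y")
  case True
  with assms(1) obtain k where "k \<in> K" "y < k" by (auto simp: mix_rel_def)
  with assms(2) have "y < v" "\<exists>k\<in>insert x K. v < k" by (auto simp: mix_rel_def)
  with True show ?thesis by (auto simp: mix_rel_def)
next
  case False
  with assms(1) have "y < x" "\<forall>k\<in>K. k < x" by (auto simp: mix_rel_def)
  moreover from this assms(2) have "v < x" unfolding mix_rel_def
    by (metis insert_iff less_asym less_trans)
  ultimately show ?thesis by (simp add: mix_rel_def)
qed

text \<open>If x < y, then y exceeds all of K and becomes a left-to-right maximum, while v is below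
  x or below an element of K. If y < x, then x is not a left-to-right maximum, so y < x < v < k for
  some k in K.\<close>

lemma mix_rel_insertI:
  assumes "\<not> mix_rel K x y" "x \<noteq> y" "y \<notin> K" "mix_rel K x v"
  shows "mix_rel (insert x K) y v"
proof (cases "x < y")
  case True
  have lt: "k < y" if "k \<in> K" for k
    using assms(1,3) that True by (metis mix_rel_def linorder_neqE_nat)
  have "v < y"
    using assms(4) True lt unfolding mix_rel_def by (metis less_trans)
  with True lt show ?thesis by (simp add: mix_rel_def)
next
  case False
  with assms(1,2) have "y < x" "\<not> (\<forall>k\<in>K. k < x)" by (auto simp: mix_rel_def)
  with assms(4) show ?thesis by (auto simp: mix_rel_def)
qed

text \<open>The left side is the condition that \<open>das\<close> puts on position i.\<close>

lemma mix_rel_descent_iff: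
  assumes p: "p permutes {1..n}" and i: "i \<in> {1..n-1}"
  shows "mix_rel (p ` {1..<i}) (p i) (p (i + 1)) \<longleftrightarrow> code mix_rel n p i > code mix_rel n p (i + 1)"
proof -
  let ?K = "p ` {1..<i}"
  have K': "p ` {1..<i+1} = insert (p i) ?K"
    using i by (simp add: atLeastLessThanSuc)
  have new: "p i \<noteq> p (i + 1)" "p (i + 1) \<notin> ?K"
    using permutes_inj[OF p] by (auto simp: inj_image_mem_iff inj_eq)
  show ?thesis
  proof (cases "mix_rel ?K (p i) (p (i + 1))")
    case True
    then have "code mix_rel n p i > code mix_rel n p (i + 1)"
      by (intro code_descentI i) (simp_all only: K', blast intro: mix_rel_insertD)
    with True show ?thesis by simp
  next
    case False
    then have "code mix_rel n p i \<le> code mix_rel n p (i + 1)"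
      using new by (intro code_ascentI i) (simp_all only: K', (blast intro: mix_rel_insertI)+)
    with False show ?thesis by simp
  qed
qed

lemma das_eq_word_des_code:
  assumes "p permutes {1..n}"
  shows "das n p = word_des n (code mix_rel n p)"
proof -
  have "das n p = card {i \<in> {1..n-1}. mix_rel (p ` {1..<i}) (p i) (p (i + 1))}"
    by (simp add: das_def mix_rel_def lr_max_def)
  also have "\<dots> = word_des n (code mix_rel n p)"
    unfolding word_des_def using mix_rel_descent_iff[OF assms]
    by (intro arg_cong[of _ _ card]) blast
  finally show ?thesis .
qed

section \<open>Transfer from words to permutations\<close>

lemma card_Collect_bij_betw:
  assumes "bij_betw f A B"
  shows "card {x \<in> A. P (f x)} = card {y \<in> B. P y}"
proof -
  have "bij_betw f {x \<in> A. P (f x)} {y \<in> B. P y}"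
    using assms by (rule bij_betw_subset) (use assms in \<open>auto simp: bij_betw_def\<close>)
  then show ?thesis by (rule bij_betw_same_card)
qed

theorem mainTheorem3:
  fixes n a b :: nat
  assumes "n \<ge> 1"
  shows "card {p. p permutes {1..n} \<and> (das n p, mix n p) = (a, b)}
       = card {p. p permutes {1..n} \<and> (des n p, inv_stat n p) = (a, b)}"
proof -
  \<comment> \<open>One predicate on words serves both pairs of statistics; only the code
    differs.\<close>
  let ?P = "\<lambda>c. (word_des n c, sum c {1..n}) = (a, b)"
  have "{p. p permutes {1..n} \<and> (das n p, mix n p) = (a, b)}
      = {p \<in> {p. p permutes {1..n}}. ?P (code mix_rel n p)}"
    by (auto simp: das_eq_word_des_code mix_eq_sum_code)
  moreover have "{p. p permutes {1..n} \<and> (des n p, inv_stat n p) = (a, b)}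
      = {p \<in> {p. p permutes {1..n}}. ?P (code inv_rel n p)}"
    by (auto simp: des_eq_word_des_code inv_stat_eq_sum_code)
  ultimately show ?thesis
    using card_Collect_bij_betw[OF bij_betw_code_mix, where P = ?P]
      card_Collect_bij_betw[OF bij_betw_code_inv, where P = ?P] by simp
qed

end
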